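(* Let $m\ge 1$, let $S=\{R_k : k=0,\dots,m-1\}$ be the group of planar rotations $R_k$ by angle $2\pi k/m$, so $|S|=m$, and let $\delta>0$. Let $F$ be the feature map obtained by discretizing a continuous function $e:\mathbb{R}^2\times S\to\mathbb{R}$ with mesh size $\delta$. Suppose there is $G\ge 0$ such that for every $R\in S$ and $x\in\mathbb{R}^2$, $$\|\nabla_x e(x,R)\|\le G.$$ Then for every $\tilde R\in S$, every $x\in\mathbb{R}^2$ and every $R\in S$, $$\left|\Phi_{\mathrm{BI}}\left(\pi^F_{\tilde R}(F)\right)(x,R)-\left[\pi^F_{\tilde R}(\Phi_{\mathrm{BI}}(F))\right](x,R)\right|\le 2(\sqrt{2}+1)\,G\,\delta .$$
   Context: Discretization: the feature map $F$ obtained from $e$ with mesh size $\delta$ has entries $F^R_{ij}=e((i\delta,j\delta),R)$ for $i,j\in\mathbb{Z}$, $R\in S$; $e(\cdot,R)$ is assumed differentiable for each $R$. Rotation action: for a function $f:\mathbb{R}^2\times S\to\mathbb{R}$ and $\tilde R\in S$, $[\pi^F_{\tilde R}(f)](x,R)=f(\tilde R^{-1}x,\tilde R^{-1}R)$. For the feature map $F$ discretized from $e$, $\pi^F_{\tilde R}(F)$ is the feature map discretized from $\pi^F_{\tilde R}(e)$, i.e. $(\pi^F_{\tilde R}(F))^R_{ij}=e(\tilde R^{-1}(i\delta,j\delta),\tilde R^{-1}R)$. Bilinear interpolation: for a feature map $F$, $\Phi_{\mathrm{BI}}(F)$ is the function on $\mathbb{R}^2\times S$ given by $$[\Phi_{\mathrm{BI}}(F)](x,R)=\sum_{v=1}^2\sum_{u=1}^2\lambda_{vu}(x)\,F^R_{i+v-1,\,j+u-1},$$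 where $x=(x_1,x_2)$, $(i,j)=(\lfloor x_1/\delta\rfloor,\lfloor x_2/\delta\rfloor)$ is the grid cell containing $x$, and the $\lambda_{vu}(x)$ are the bilinear interpolation weights of $x$ in its cell; they satisfy $\lambda_{vu}(x)\ge 0$ and $\sum_{v,u}\lambda_{vu}(x)=1$. Explicitly, with $s=x_1/\delta-i$ and $t=x_2/\delta-j$: $\lambda_{11}=(1-s)(1-t)$, $\lambda_{21}=s(1-t)$, $\lambda_{12}=(1-s)t$, $\lambda_{22}=st$. Norms on $\mathbb{R}^2$ are Euclidean. *)

theory Defs
  imports "HOL-Analysis.Analysis"
begin

definition planar_rotation :: "real \<Rightarrow> real ^ 2 ^ 2" where
  "planar_rotation \<theta> = vector [vector [cos \<theta>, - sin \<theta>], vector [sin \<theta>, cos \<theta>]]"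

definition cyclic_rotations :: "nat \<Rightarrow> (real ^ 2 ^ 2) set" where
  "cyclic_rotations m = {planar_rotation (2 * pi * real k / real m) | k. k < m}"

(* Functions on R^2 x S are represented by functions on R^2 x R^(2x2); only their values
   at matrices in S = cyclic_rotations m are relevant. *)

definition rotate_fun ::
  "real ^ 2 ^ 2 \<Rightarrow> ((real ^ 2) \<times> (real ^ 2 ^ 2) \<Rightarrow> real) \<Rightarrow> ((real ^ 2) \<times> (real ^ 2 ^ 2) \<Rightarrow> real)" where
  "rotate_fun Q f = (\<lambda>(x, R). f (matrix_inv Q *v x, matrix_inv Q ** R))"

type_synonym feature_map = "int \<Rightarrow> int \<Rightarrow> real ^ 2 ^ 2 \<Rightarrow> real"

definition discretize :: "real \<Rightarrow> ((real ^ 2) \<times> (real ^ 2 ^ 2) \<Rightarrow> real) \<Rightarrow> feature_map" where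
  "discretize \<delta> e = (\<lambda>i j R. e (vector [real_of_int i * \<delta>, real_of_int j * \<delta>], R))"

(* The rotation action on a feature map refers to the function e the map was discretized
   from: the grid values alone do not determine the values at rotated grid points. *)
definition rotate_discretized ::
  "real \<Rightarrow> real ^ 2 ^ 2 \<Rightarrow> ((real ^ 2) \<times> (real ^ 2 ^ 2) \<Rightarrow> real) \<Rightarrow> feature_map" where
  "rotate_discretized \<delta> Q e = discretize \<delta> (rotate_fun Q e)"

definition bilinear_weight :: "real \<Rightarrow> nat \<Rightarrow> nat \<Rightarrow> real ^ 2 \<Rightarrow> real" where
  "bilinear_weight \<delta> v u x =
     (let s = x $ 1 / \<delta> - of_int \<lfloor>x $ 1 / \<delta>\<rfloor>;
          t = x $ 2 / \<delta> - of_int \<lfloor>x $ 2 / \<delta>\<rfloor>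
      in (if v = 1 then 1 - s else s) * (if u = 1 then 1 - t else t))"

definition bilinear_interp :: "real \<Rightarrow> feature_map \<Rightarrow> ((real ^ 2) \<times> (real ^ 2 ^ 2) \<Rightarrow> real)" where
  "bilinear_interp \<delta> F = (\<lambda>(x, R).
     \<Sum>v = 1..2. \<Sum>u = 1..2. bilinear_weight \<delta> v u x *
       F (\<lfloor>x $ 1 / \<delta>\<rfloor> + int v - 1) (\<lfloor>x $ 2 / \<delta>\<rfloor> + int u - 1) R)"

(* Meaningful only where f is differentiable, see GDERIV_gradient. *)
definition gradient :: "(real ^ 2 \<Rightarrow> real) \<Rightarrow> real ^ 2 \<Rightarrow> real ^ 2" where
  "gradient f x = (THE D. GDERIV f x :> D)"

lemma GDERIV_gradient:
  assumes "f differentiable (at x)"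
  shows "GDERIV f x :> gradient f x"
proof -
  obtain f' where f': "(f has_derivative f') (at x)"
    using assms by (auto simp: differentiable_def)
  interpret f': bounded_linear f' using f' by (rule has_derivative_bounded_linear)
  have "f' = (\<lambda>h. inner h (adjoint f' 1))"
    by (rule ext) (simp add: adjoint_works[OF f'.linear_axioms])
  with f' have "GDERIV f x :> adjoint f' 1" by (simp add: gderiv_def)
  moreover have "D = E" if "GDERIV f x :> D" "GDERIV f x :> E" for D E
  proof -
    have "(\<lambda>h. inner h D) = (\<lambda>h. inner h E)"
      using that unfolding gderiv_def by (rule has_derivative_unique)
    then show ?thesis using vector_eq_rdot[of D E] by (simp add: fun_eq_iff inner_commute)
  qed
  ultimately have "\<exists>!D. GDERIV f x :> D" by blast
  then show ?thesis unfolding gradient_def by (rule theI')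
qed

lemma planar_rotation_mult: "planar_rotation a ** planar_rotation b = planar_rotation (a + b)"
  by (simp add: planar_rotation_def matrix_matrix_mult_def vec_eq_iff forall_2 sum_2
      cos_add sin_add algebra_simps)

lemma card_cyclic_rotations: "card (cyclic_rotations m) = m"
proof -
  have "inj_on (\<lambda>k. planar_rotation (2 * pi * real k / real m)) {..<m}"
  proof (rule inj_onI)
    fix k l assume kl: "k \<in> {..<m}" "l \<in> {..<m}"
      and eq: "planar_rotation (2 * pi * real k / real m) = planar_rotation (2 * pi * real l / real m)"
    let ?a = "2 * pi * real k / real m" and ?b = "2 * pi * real l / real m"
    have m: "m > 0" using kl by auto
    have "cos ?a = cos ?b \<and> sin ?a = sin ?b"
      using eq by (simp add: planar_rotation_def vec_eq_iff forall_2)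
    moreover have "0 \<le> ?a" "?a < 2 * pi" "0 \<le> ?b" "?b < 2 * pi"
      using kl m by (auto simp: field_simps)
    ultimately have cs: "cos ?a = cos ?b" "sin ?a = sin ?b" and lt: "\<bar>?a - ?b\<bar> < 2 * pi"
      by linarith+
    have "cos (?a - ?b) = 1"
      unfolding cos_diff cs by (metis power2_eq_square sin_cos_squared_add2)
    then obtain n :: int where n: "?a - ?b = of_int n * 2 * pi"
      using cos_one_2pi_int by blast
    with lt have "\<bar>real_of_int n\<bar> * (2 * pi) < 1 * (2 * pi)"
      by (simp add: abs_mult)
    then have "n = 0"
      using pi_gt_zero by (subst (asm) mult_less_cancel_right_pos) auto
    with n have "?a = ?b" by simp
    then show "k = l" using m by (simp add: field_simps)
  qed
  moreover have "cyclic_rotations m = (\<lambda>k. planar_rotation (2 * pi * real k / real m)) ` {..<m}"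
    by (auto simp: cyclic_rotations_def)
  ultimately show ?thesis by (simp add: card_image)
qed

end

theory Submission
  imports Defs
begin

text \<open>
  Bilinear interpolation is a convex combination of samples at the four corners of the grid cell
  containing \<open>x\<close>, each within \<open>sqrt 2 * \<delta>\<close> of \<open>x\<close>. The gradient bound makes \<open>e(\<cdot>, R)\<close> and, rotations
  being isometries, also the rotated function \<open>G\<close>-Lipschitz, so each of the two interpolants is
  within \<open>sqrt 2 * G * \<delta>\<close> of the same value of \<open>e\<close>. This yields the bound \<open>2 * sqrt 2 * G * \<delta>\<close>.
\<close>

lemma planar_rotation_0: "planar_rotation 0 = mat 1"
  by (simp add: planar_rotation_def mat_def vec_eq_iff forall_2)

lemma planar_rotation_add_2pi: "planar_rotation (\<theta> + 2 * pi) = planar_rotation \<theta>"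
  by (simp add: planar_rotation_def)

text \<open>\<open>matrix_inv\<close> is a Hilbert choice. Two-sided inverses are unique by
  associativity, so the choice is forced.\<close>

lemma matrix_inv_unique:
  fixes A :: "'a::semiring_1 ^ 'n ^ 'n"
  assumes "A ** B = mat 1" and "B ** A = mat 1"
  shows "matrix_inv A = B"
  unfolding matrix_inv_def
proof (rule some_equality)
  show "A ** B = mat 1 \<and> B ** A = mat 1" using assms by simp
next
  fix C assume "A ** C = mat 1 \<and> C ** A = mat 1"
  then show "C = B" by (metis assms(2) matrix_mul_assoc matrix_mul_lid matrix_mul_rid)
qed

lemma matrix_inv_planar_rotation: "matrix_inv (planar_rotation \<theta>) = planar_rotation (- \<theta>)"
  by (rule matrix_inv_unique) (simp_all add: planar_rotation_mult planar_rotation_0)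

lemma norm_planar_rotation: "norm (planar_rotation \<theta> *v x) = norm x"
proof -
  \<comment> \<open>The cross terms cancel. The Pythagorean simp rules are switched off so that both
    sides expand to the same polynomial in \<open>sin \<theta>\<close> and
    \<open>cos \<theta>\<close>.\<close>
  have "(planar_rotation \<theta> *v x) \<bullet> (planar_rotation \<theta> *v x)
      = ((sin \<theta>)\<^sup>2 + (cos \<theta>)\<^sup>2) * (x \<bullet> x)"
    unfolding planar_rotation_def
    by (simp add: matrix_vector_mult_def inner_vec_def sum_2 power2_eq_square algebra_simps
        del: sin_cos_squared_add sin_cos_squared_add2 sin_cos_squared_add3)
  then show ?thesis by (simp add: norm_eq_sqrt_inner)
qed

text \<open>Needed because \<open>rotate_fun\<close> evaluates \<open>e\<close> at
  \<open>matrix_inv Q ** R\<close>, while the hypotheses on \<open>e\<close> speak only of matrices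
  in \<open>cyclic_rotations m\<close>.\<close>

lemma cyclic_rotations_inv_mult:
  assumes "Q \<in> cyclic_rotations m" and "R \<in> cyclic_rotations m"
  shows "matrix_inv Q ** R \<in> cyclic_rotations m"
proof -
  obtain k l where k: "k < m" "Q = planar_rotation (2 * pi * real k / real m)"
    and l: "l < m" "R = planar_rotation (2 * pi * real l / real m)"
    using assms by (auto simp: cyclic_rotations_def)
  let ?\<theta> = "2 * pi * real l / real m - 2 * pi * real k / real m"
  have eq: "matrix_inv Q ** R = planar_rotation ?\<theta>"
    by (simp add: k l matrix_inv_planar_rotation planar_rotation_mult)
  show ?thesis
  proof (cases "k \<le> l")
    case True
    then have "?\<theta> = 2 * pi * real (l - k) / real m"
      by (simp add: of_nat_diff diff_divide_distrib right_diff_distrib)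
    moreover have "l - k < m" using l(1) by linarith
    ultimately show ?thesis
      unfolding cyclic_rotations_def mem_Collect_eq eq by metis
  next
    case False
    \<comment> \<open>The angle is negative here; a full turn, that is \<open>m\<close> steps,
      brings the index back into the range from 0 to \<open>m - 1\<close>.\<close>
    then have "?\<theta> + 2 * pi = 2 * pi * real (l + m - k) / real m"
      using k(1) by (simp add: of_nat_diff add_divide_distrib diff_divide_distrib
          right_diff_distrib distrib_left)
    then have "matrix_inv Q ** R = planar_rotation (2 * pi * real (l + m - k) / real m)"
      unfolding eq by (metis planar_rotation_add_2pi)
    moreover have "l + m - k < m" using False k(1) by linarith
    ultimately show ?thesis unfolding cyclic_rotations_def mem_Collect_eq by metis
  qed
qed

text \<open>Mean value inequality on the convex set \<open>UNIV\<close>; Cauchy-Schwarz bounds the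
  operator norm of the derivative by the norm of the gradient.\<close>

lemma gradient_bound_imp_lipschitz:
  assumes diff: "\<forall>x. f differentiable (at x)" and bound: "\<forall>x. norm (gradient f x) \<le> G"
  shows "\<bar>f y - f x\<bar> \<le> G * norm (y - x)"
proof -
  have "norm (f y - f x) \<le> G * norm (y - x)"
  proof (rule differentiable_bound[where S = UNIV and f' = "\<lambda>z h. h \<bullet> gradient f z"])
    show "(f has_derivative (\<lambda>h. h \<bullet> gradient f z)) (at z within UNIV)" for z
      using GDERIV_gradient diff by (auto simp: gderiv_def)
    show "onorm (\<lambda>h. h \<bullet> gradient f z) \<le> G" for z
    proof (rule onorm_le)
      fix h
      have "norm (h \<bullet> gradient f z) \<le> norm h * norm (gradient f z)"
        using Cauchy_Schwarz_ineq2 by simp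
      also have "\<dots> \<le> G * norm h"
        using mult_right_mono[OF bound[rule_format] norm_ge_zero] by (simp add: mult.commute)
      finally show "norm (h \<bullet> gradient f z) \<le> G * norm h" .
    qed
  qed auto
  then show ?thesis by simp
qed

lemma bilinear_weight_nonneg: "0 \<le> bilinear_weight \<delta> v u x"
proof -
  have "0 \<le> z - of_int \<lfloor>z\<rfloor>" "z - of_int \<lfloor>z\<rfloor> \<le> 1" for z :: real
    by linarith+
  then show ?thesis by (simp add: bilinear_weight_def Let_def)
qed

text \<open>The sum factors as \<open>((1 - s) + s) * ((1 - t) + t)\<close>.\<close>

lemma sum_bilinear_weight: "(\<Sum>v = 1..2. \<Sum>u = 1..2. bilinear_weight \<delta> v u x) = 1"
  by (simp add: bilinear_weight_def Let_def numeral_2_eq_2 algebra_simps)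

text \<open>The offset \<open>v - 1\<close> is 0 or 1, so the index is one of the two integers
  enclosing \<open>z / \<delta>\<close>; scaling by \<open>\<delta>\<close> gives the bound.\<close>

lemma grid_coordinate_dist:
  fixes \<delta> z :: real
  assumes "\<delta> > 0" and "v \<in> {1..2}"
  shows "\<bar>of_int (\<lfloor>z / \<delta>\<rfloor> + int v - 1) * \<delta> - z\<bar> \<le> \<delta>"
proof -
  have "v = 1 \<or> v = 2" using assms(2) by auto
  then have "\<bar>of_int (\<lfloor>z / \<delta>\<rfloor> + int v - 1) - z / \<delta>\<bar> \<le> 1"
    by (elim disjE) (simp, linarith)+
  then have "\<bar>of_int (\<lfloor>z / \<delta>\<rfloor> + int v - 1) - z / \<delta>\<bar> * \<delta> \<le> \<delta>"
    using assms(1) by (simp add: mult_left_le_one_le)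
  also have "\<bar>of_int (\<lfloor>z / \<delta>\<rfloor> + int v - 1) - z / \<delta>\<bar> * \<delta>
      = \<bar>(of_int (\<lfloor>z / \<delta>\<rfloor> + int v - 1) - z / \<delta>) * \<delta>\<bar>"
    using assms(1) by (simp add: abs_mult)
  also have "(of_int (\<lfloor>z / \<delta>\<rfloor> + int v - 1) - z / \<delta>) * \<delta>
      = of_int (\<lfloor>z / \<delta>\<rfloor> + int v - 1) * \<delta> - z"
    using assms(1) by (simp add: left_diff_distrib)
  finally show ?thesis .
qed

lemma norm_le_sqrt2:
  fixes y :: "real ^ 2"
  assumes "\<bar>y $ 1\<bar> \<le> \<delta>" and "\<bar>y $ 2\<bar> \<le> \<delta>"
  shows "norm y \<le> sqrt 2 * \<delta>"
proof -
  have "(y $ 1)\<^sup>2 \<le> \<delta>\<^sup>2" "(y $ 2)\<^sup>2 \<le> \<delta>\<^sup>2"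
    using assms by (auto intro: power2_le_iff_abs_le[THEN iffD2])
  then have "norm y \<le> sqrt (2 * \<delta>\<^sup>2)"
    by (simp add: norm_vec_def L2_set_def sum_2)
  \<comment> \<open>The assumptions force \<open>\<delta> \<ge> 0\<close>, so the root of its square
    is \<open>\<delta>\<close> itself.\<close>
  also have "\<dots> = sqrt 2 * \<delta>"
    using assms by (simp add: real_sqrt_mult)
  finally show ?thesis .
qed

text \<open>The error is a weighted average of the deviations at the four corners. Fixing
  \<open>R\<close> and anchoring the Lipschitz estimate at \<open>x\<close> lets the lemma serve
  both \<open>e\<close> and its rotated version.\<close>

lemma bilinear_interp_error:
  assumes "\<delta> > 0" and "L \<ge> 0"
    and lip: "\<And>y. \<bar>f (y, R) - f (x, R)\<bar> \<le> L * norm (y - x)"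
  shows "\<bar>bilinear_interp \<delta> (discretize \<delta> f) (x, R) - f (x, R)\<bar> \<le> L * (sqrt 2 * \<delta>)"
proof -
  define p :: "nat \<Rightarrow> nat \<Rightarrow> real ^ 2" where
    "p v u = vector [of_int (\<lfloor>x $ 1 / \<delta>\<rfloor> + int v - 1) * \<delta>,
                     of_int (\<lfloor>x $ 2 / \<delta>\<rfloor> + int u - 1) * \<delta>]" for v u
  let ?w = "\<lambda>v u. bilinear_weight \<delta> v u x"
  have corner: "\<bar>f (p v u, R) - f (x, R)\<bar> \<le> L * (sqrt 2 * \<delta>)"
    if "v \<in> {1..2}" "u \<in> {1..2}" for v u
  proof -
    have "norm (p v u - x) \<le> sqrt 2 * \<delta>"
      unfolding p_def using grid_coordinate_dist[OF assms(1)] that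
      by (intro norm_le_sqrt2) auto
    then show ?thesis
      using lip[of "p v u"] assms(2) by (meson mult_left_mono order_trans)
  qed
  \<comment> \<open>Multiplying by the total weight 1 allows the subtraction to be carried out
    corner by corner.\<close>
  have "f (x, R) = (\<Sum>v = 1..2. \<Sum>u = 1..2. ?w v u) * f (x, R)"
    by (simp only: sum_bilinear_weight mult_1)
  then have "bilinear_interp \<delta> (discretize \<delta> f) (x, R) - f (x, R)
      = (\<Sum>v = 1..2. \<Sum>u = 1..2. ?w v u * f (p v u, R))
        - (\<Sum>v = 1..2. \<Sum>u = 1..2. ?w v u) * f (x, R)"
    by (simp only: bilinear_interp_def discretize_def p_def prod.case)
  also have "\<dots> = (\<Sum>v = 1..2. \<Sum>u = 1..2. ?w v u * (f (p v u, R) - f (x, R)))"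
    by (simp only: sum_distrib_right sum_subtractf right_diff_distrib)
  also have "\<bar>\<dots>\<bar> \<le> (\<Sum>v = 1..2. \<Sum>u = 1..2. ?w v u * (L * (sqrt 2 * \<delta>)))"
    using corner
    by (intro order_trans[OF sum_abs] sum_mono)
      (auto simp: abs_mult bilinear_weight_nonneg intro!: mult_left_mono)
  also have "\<dots> = L * (sqrt 2 * \<delta>)"
    by (simp only: sum_distrib_right[symmetric] sum_bilinear_weight mult_1)
  finally show ?thesis .
qed

theorem theorem3p2:
  fixes m :: nat and \<delta> G :: real
    and e :: "(real ^ 2) \<times> (real ^ 2 ^ 2) \<Rightarrow> real"
    and F :: feature_map
  assumes "m \<ge> 1" and "\<delta> > 0"
    and "continuous_on (UNIV \<times> cyclic_rotations m) e"
    and "\<forall>R\<in>cyclic_rotations m. \<forall>x. (\<lambda>y. e (y, R)) differentiable (at x)"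
    and "F = discretize \<delta> e"
    and "G \<ge> 0"
    and "\<forall>R\<in>cyclic_rotations m. \<forall>x. norm (gradient (\<lambda>y. e (y, R)) x) \<le> G"
  shows "\<forall>Q\<in>cyclic_rotations m. \<forall>x. \<forall>R\<in>cyclic_rotations m.
    \<bar>bilinear_interp \<delta> (rotate_discretized \<delta> Q e) (x, R)
      - rotate_fun Q (bilinear_interp \<delta> F) (x, R)\<bar> \<le> 2 * (sqrt 2 + 1) * G * \<delta>"
proof (intro ballI allI)
  fix Q x R
  assume Q: "Q \<in> cyclic_rotations m" and R: "R \<in> cyclic_rotations m"
  let ?R = "matrix_inv Q ** R" and ?x = "matrix_inv Q *v x"
  have "?R \<in> cyclic_rotations m"
    using Q R by (rule cyclic_rotations_inv_mult)
  then have lip: "\<bar>e (y, ?R) - e (z, ?R)\<bar> \<le> G * norm (y - z)" for y z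
    using assms(4,7) by (intro gradient_bound_imp_lipschitz) auto
  have "norm (matrix_inv Q *v y) = norm y" for y
    using Q by (auto simp: cyclic_rotations_def matrix_inv_planar_rotation norm_planar_rotation)
  \<comment> \<open>By linearity the rotated points differ by the rotated \<open>y - x\<close>,
    which has the same norm, so the constant \<open>G\<close> is preserved.\<close>
  then have "\<bar>rotate_fun Q e (y, R) - rotate_fun Q e (x, R)\<bar> \<le> G * norm (y - x)" for y
    using lip[of "matrix_inv Q *v y" ?x]
    by (simp add: rotate_fun_def flip: matrix_vector_mult_diff_distrib)
  then have 1: "\<bar>bilinear_interp \<delta> (rotate_discretized \<delta> Q e) (x, R) - rotate_fun Q e (x, R)\<bar>
      \<le> G * (sqrt 2 * \<delta>)"
    unfolding rotate_discretized_def by (rule bilinear_interp_error[OF assms(2,6)])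
  \<comment> \<open>The reference value \<open>e (?x, ?R)\<close> is
    \<open>rotate_fun Q e (x, R)\<close> unfolded, so the triangle inequality can join the two
    estimates.\<close>
  have 2: "\<bar>bilinear_interp \<delta> F (?x, ?R) - e (?x, ?R)\<bar> \<le> G * (sqrt 2 * \<delta>)"
    unfolding assms(5) by (rule bilinear_interp_error[OF assms(2,6) lip])
  \<comment> \<open>The two errors account for the first summand; the second is nonnegative
    slack.\<close>
  have "2 * (sqrt 2 + 1) * G * \<delta> = 2 * (G * (sqrt 2 * \<delta>)) + 2 * (G * \<delta>)"
    by (simp add: algebra_simps)
  moreover have "0 \<le> G * \<delta>" using assms(2,6) by simp
  ultimately show "\<bar>bilinear_interp \<delta> (rotate_discretized \<delta> Q e) (x, R)
      - rotate_fun Q (bilinear_interp \<delta> F) (x, R)\<bar> \<le> 2 * (sqrt 2 + 1) * G * \<delta>"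
    using 1 2 unfolding rotate_fun_def prod.case by linarith
qed

end
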